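(* When the arrivals of tasks in the task set $\mathcal{T}$ follow a uniform distribution, HERALD* (defined in the context) achieves a competitive ratio of $\mathcal{O}(\ln(l n))$ on expected social cost, where $l$ is the number of task subsets and $n$ the number of tasks. That is, $$\max_{k\in\{1,\dots,n\}}\ \mathbb{E}_{\mathcal{P}}\left[\frac{\mathbb{E}_{\mathcal{A}}[C(\mathcal{S}(\mathcal{A},W))]}{\mathbb{E}_{\mathcal{A}}[C_{\mathcal{OPT}}(\mathcal{A},W)]}\right]=\mathcal{O}(\ln(l n)),$$ with an absolute implied constant.
   Context: Setting. $\mathcal{W}=\{1,\dots,m\}$ is a set of workers (also written $W$); $\mathcal{T}=\{\tau_1,\dots,\tau_n\}$ is a set of $n$ distinct tasks; $\mathcal{Y}=\{\Gamma_1,\dots,\Gamma_l\}$ is a family of $l<mn$ task subsets with $\bigcup_{j=1}^l\Gamma_j=\mathcal{T}$, each task lying in at least two of the $\Gamma_j$. Each worker $i$ has a cost $c_i$ and bids truthfully: $b_i=c_i\in[b_{\min},b_{\max}]$, with $b_{\min}=1$ and $b_{\max}$ a constant. Matching phase. Given a score function $u$ with sensitivity $\Delta u$ and a constant $\epsilon>0$, for each $\Gamma_j\in\mathcal{Y}$ a worker $i$ is drawn at random with probability proportional to $\exp\left(\frac{\epsilon u(b_i)}{2\Delta u}\right)$, and the pair $(\Gamma_j,b_i)$ is put in the matching set $\mathcal{P}$. $\mathbb{E}_{\mathcal{P}}$ is the expectation over the resulting matching sets. Arrivals. For a number $k$ of simultaneously arriving tasks, $\mathcal{A}$ is the random multiset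 of $k$ tasks drawn independently and uniformly from $\mathcal{T}$ (repetitions allowed), and $\mathbb{E}_{\mathcal{A}}$ (or $\mathbb{E}$) is the expectation over $\mathcal{A}$. $C_{\mathcal{OPT}}(\mathcal{A},W)$ is the minimum social cost for $\mathcal{A}$, i.e. the minimum of the sum of costs $c_i$ over sets of matching pairs $(\Gamma_j,b_i)\in\mathcal{P}$ whose task subsets cover $\mathcal{A}$. Winning selection phase (for given $\mathcal{P}$ and $k$). Set $T=64\,\mathbb{E}[C_{\mathcal{OPT}}(\mathcal{A},W)]$ (fixed throughout) and $\mathcal{S}=\emptyset$. Let $\widetilde{\mathcal{T}}$ denote the current set of uncovered tasks, initially $\mathcal{T}$. While $\widetilde{\mathcal{T}}\neq\emptyset$: for each pair $(\Gamma_j,b_i)\in\mathcal{P}$ let its cost-effectiveness (CF) be $b_i/|\Gamma_j\cap\widetilde{\mathcal{T}}|$ (infinite if the intersection is empty). Type I selection: if some pair has CF $\le T/|\widetilde{\mathcal{T}}|$, select a pair with minimum CF. Type II selection: otherwise, select a pair with the lowest bid among those pairs whose subset contains at least one uncovered task. Add the selected pair $(\Gamma_j,b_i)$ to $\mathcal{S}$, remove it from $\mathcal{P}$, and replace $\widetilde{\mathcal{T}}$ by $\widetilde{\mathcal{T}}\setminus\Gamma_j$. (A payment phase follows, which does not affect social cost.) Social cost. For a multiset $\mathcal{A}$ of arriving tasks, $\mathcal{S}(\mathcal{A},W)$ is the set of winning pairs in $\mathcal{S}$ used to serve $\mathcal{A}$: each task is served by the winning pair that first covered it, so $(\Gamma_j,c_i)\in\mathcal{S}(\mathcal{A},W)$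 if and only if $\mathcal{A}$ meets $\Gamma_j\cap\widetilde{\mathcal{T}}$, where $\widetilde{\mathcal{T}}$ is the uncovered set just before the pair was selected; in particular $\mathcal{S}(\mathcal{A},W)$ covers $\mathcal{A}$ and $\Gamma_j\cap\mathcal{A}\ne\emptyset$ for each of its pairs. Its social cost is $C(\mathcal{S}(\mathcal{A},W))=\sum_{(\Gamma_j,c_i)\in\mathcal{S}(\mathcal{A},W)}c_i$. *)

theory Defs
  imports "HOL-Probability.Probability"
begin

text \<open>
  Workers are \<open>1..m\<close>, the tasks \<open>\<tau>\<^sub>1, \<dots>, \<tau>\<^sub>n\<close> are identified with their indices \<open>1..n\<close>, and the
  task subsets are \<open>\<Gamma> 1, \<dots>, \<Gamma> l\<close>. Tasks are numbers rather than elements of a type variable,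
  so that a constant chosen before the instance cannot depend on the type of tasks.
  A matching pair consists of a task subset and a bid. Bids are truthful, so the bid of
  worker \<open>i\<close> is the cost \<open>c i\<close>.
\<close>

type_synonym matching_pair = "nat set \<times> real"

definition sensitivity :: "(real \<Rightarrow> real) \<Rightarrow> real set \<Rightarrow> real" where
  "sensitivity u B = (SUP (x, y)\<in>B \<times> B. \<bar>u x - u y\<bar>)"

definition score_weight :: "real \<Rightarrow> (real \<Rightarrow> real) \<Rightarrow> real \<Rightarrow> real \<Rightarrow> real" where
  "score_weight \<epsilon> u \<Delta>u b = exp (\<epsilon> * u b / (2 * \<Delta>u))"

definition worker_pmf ::
  "nat \<Rightarrow> (nat \<Rightarrow> real) \<Rightarrow> real \<Rightarrow> (real \<Rightarrow> real) \<Rightarrow> real \<Rightarrow> nat pmf" where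
  "worker_pmf m c \<epsilon> u \<Delta>u = embed_pmf (\<lambda>i.
     if i \<in> {1..m}
     then score_weight \<epsilon> u \<Delta>u (c i) / (\<Sum>i'=1..m. score_weight \<epsilon> u \<Delta>u (c i'))
     else 0)"

lemma pmf_worker_pmf:
  assumes "m \<ge> 1"
  shows "pmf (worker_pmf m c \<epsilon> u \<Delta>u) i =
    (if i \<in> {1..m}
     then score_weight \<epsilon> u \<Delta>u (c i) / (\<Sum>i'=1..m. score_weight \<epsilon> u \<Delta>u (c i'))
     else 0)"
proof -
  define w where "w i = score_weight \<epsilon> u \<Delta>u (c i)" for i
  define Z where "Z = (\<Sum>i'=1..m. w i')"
  have w_pos: "w i > 0" for i by (simp add: w_def score_weight_def)
  have Z_pos: "Z > 0" unfolding Z_def using assms w_pos by (intro sum_pos) auto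
  have nonneg: "0 \<le> (if i \<in> {1..m} then w i / Z else 0)" for i
    using w_pos[of i] Z_pos by simp
  have "(\<integral>\<^sup>+i. ennreal (if i \<in> {1..m} then w i / Z else 0) \<partial>count_space UNIV) =
        (\<Sum>i=1..m. ennreal (w i / Z))"
    by (subst nn_integral_count_space'[of "{1..m}"]) auto
  also have "\<dots> = ennreal (\<Sum>i=1..m. w i / Z)"
    using w_pos Z_pos by (intro sum_ennreal) (simp add: less_imp_le)
  also have "(\<Sum>i=1..m. w i / Z) = 1"
    using Z_pos unfolding Z_def by (simp flip: sum_divide_distrib)
  finally have "(\<integral>\<^sup>+i. ennreal (if i \<in> {1..m} then w i / Z else 0) \<partial>count_space UNIV) = 1"
    by simp
  from pmf_embed_pmf[OF nonneg this] show ?thesis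
    unfolding worker_pmf_def Z_def w_def by simp
qed

text \<open>The workers for \<open>\<Gamma> 1, \<dots>, \<Gamma> l\<close> are drawn independently.\<close>

definition matching_pmf ::
  "nat \<Rightarrow> nat \<Rightarrow> (nat \<Rightarrow> nat set) \<Rightarrow> (nat \<Rightarrow> real) \<Rightarrow> real \<Rightarrow> (real \<Rightarrow> real) \<Rightarrow> real
    \<Rightarrow> matching_pair set pmf" where
  "matching_pmf m l \<Gamma> c \<epsilon> u \<Delta>u =
     map_pmf (\<lambda>w. (\<lambda>j. (\<Gamma> j, c (w j))) ` {1..l})
       (Pi_pmf {1..l} 0 (\<lambda>_. worker_pmf m c \<epsilon> u \<Delta>u))"

definition arrivals_pmf :: "nat \<Rightarrow> nat \<Rightarrow> nat multiset pmf" where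
  "arrivals_pmf n k = map_pmf mset (replicate_pmf k (pmf_of_set {1..n}))"

definition opt_cost :: "matching_pair set \<Rightarrow> nat multiset \<Rightarrow> real" where
  "opt_cost P A =
     Min {\<Sum>p\<in>Q. snd p | Q. Q \<subseteq> P \<and> set_mset A \<subseteq> (\<Union>p\<in>Q. fst p)}"

definition expected_opt :: "nat \<Rightarrow> nat \<Rightarrow> matching_pair set \<Rightarrow> real" where
  "expected_opt n k P = measure_pmf.expectation (arrivals_pmf n k) (opt_cost P)"

definition cost_effectiveness :: "nat set \<Rightarrow> matching_pair \<Rightarrow> ereal" where
  "cost_effectiveness U p =
     (if fst p \<inter> U = {} then \<infinity> else ereal (snd p / real (card (fst p \<inter> U))))"

text \<open>
  \<open>may_select T P U p\<close>: with threshold \<open>T\<close>, remaining pairs \<open>P\<close> and uncovered tasks \<open>U\<close>, the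
  pair \<open>p\<close> is an admissible choice. Ties are left open, so there may be several such pairs.
\<close>

definition may_select ::
  "real \<Rightarrow> matching_pair set \<Rightarrow> nat set \<Rightarrow> matching_pair \<Rightarrow> bool" where
  "may_select T P U p \<longleftrightarrow>
     (if \<exists>q\<in>P. cost_effectiveness U q \<le> ereal (T / real (card U))
      then p \<in> P \<and> (\<forall>q\<in>P. cost_effectiveness U p \<le> cost_effectiveness U q)
      else p \<in> P \<and> fst p \<inter> U \<noteq> {} \<and> (\<forall>q\<in>P. fst q \<inter> U \<noteq> {} \<longrightarrow> snd p \<le> snd q))"

text \<open>
  \<open>herald_run T P U S\<close>: \<open>S\<close> is the log of a complete run of the winning selection phase from
  remaining pairs \<open>P\<close> and uncovered tasks \<open>U\<close>. Each selected pair is logged together with the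
  set of tasks that were uncovered just before its selection.
\<close>

inductive herald_run ::
  "real \<Rightarrow> matching_pair set \<Rightarrow> nat set \<Rightarrow> (matching_pair \<times> nat set) list \<Rightarrow> bool"
  for T :: real where
  stop: "herald_run T P {} []"
| step: "U \<noteq> {} \<Longrightarrow> may_select T P U p \<Longrightarrow> herald_run T (P - {p}) (U - fst p) S
         \<Longrightarrow> herald_run T P U ((p, U) # S)"

lemma ex_may_select:
  assumes "finite P" and "U \<noteq> {}" and "U \<subseteq> (\<Union>p\<in>P. fst p)"
  shows "\<exists>p. may_select T P U p \<and> fst p \<inter> U \<noteq> {}"
proof (cases "\<exists>q\<in>P. cost_effectiveness U q \<le> ereal (T / real (card U))")
  case True
  then obtain q where q: "q \<in> P" "cost_effectiveness U q \<le> ereal (T / real (card U))" by blast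
  then obtain p where p: "p \<in> P" "\<forall>q\<in>P. cost_effectiveness U p \<le> cost_effectiveness U q"
    using ex_min_if_finite[of "cost_effectiveness U ` P"] assms(1)
    by (metis (no_types, lifting) empty_iff finite_imageI image_iff linorder_not_less)
  have "cost_effectiveness U p \<le> ereal (T / real (card U))"
    using p q by (meson order_trans)
  then have "fst p \<inter> U \<noteq> {}" by (auto simp: cost_effectiveness_def)
  moreover have "may_select T P U p" using True p unfolding may_select_def by simp
  ultimately show ?thesis by blast
next
  case False
  define P' where "P' = {p \<in> P. fst p \<inter> U \<noteq> {}}"
  have "finite P'" using assms(1) by (simp add: P'_def)
  moreover obtain t where "t \<in> U" using assms(2) by blast
  with assms(3) obtain q where "q \<in> P" "t \<in> fst q" by blast
  with \<open>t \<in> U\<close> have "P' \<noteq> {}" unfolding P'_def by blast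
  ultimately obtain p where "p \<in> P'" "\<forall>q\<in>P'. snd p \<le> snd q"
    by (metis arg_min_if_finite(1) arg_min_least)
  then have p: "p \<in> P" "fst p \<inter> U \<noteq> {}" "\<forall>q\<in>P. fst q \<inter> U \<noteq> {} \<longrightarrow> snd p \<le> snd q"
    unfolding P'_def by blast+
  then have "may_select T P U p" using False unfolding may_select_def by simp
  with p show ?thesis by blast
qed

lemma ex_herald_run:
  assumes "finite P" and "finite U" and "U \<subseteq> (\<Union>p\<in>P. fst p)"
  shows "\<exists>S. herald_run T P U S"
  using assms
proof (induction "card U" arbitrary: P U rule: less_induct)
  case less
  show ?case
  proof (cases "U = {}")
    case True
    then show ?thesis by (blast intro: herald_run.stop)
  next
    case False
    obtain p where p: "may_select T P U p" "fst p \<inter> U \<noteq> {}"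
      using ex_may_select[OF less.prems(1) False less.prems(3)] by blast
    have "card (U - fst p) < card U"
      using less.prems(2) p(2) by (intro psubset_card_mono) auto
    moreover have "U - fst p \<subseteq> (\<Union>q\<in>P - {p}. fst q)"
      using less.prems(3) by blast
    ultimately obtain S where "herald_run T (P - {p}) (U - fst p) S"
      using less.hyps[of "U - fst p" "P - {p}"] less.prems by auto
    then show ?thesis using False p by (blast intro: herald_run.step)
  qed
qed

definition winners :: "(matching_pair \<times> nat set) list \<Rightarrow> nat multiset \<Rightarrow> matching_pair set" where
  "winners S A = {p. \<exists>U. (p, U) \<in> set S \<and> set_mset A \<inter> (fst p \<inter> U) \<noteq> {}}"

definition social_cost :: "(matching_pair \<times> nat set) list \<Rightarrow> nat multiset \<Rightarrow> real" where
  "social_cost S A = (\<Sum>p\<in>winners S A. snd p)"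

definition expected_social_cost ::
  "nat \<Rightarrow> nat \<Rightarrow> (matching_pair \<times> nat set) list \<Rightarrow> real" where
  "expected_social_cost n k S = measure_pmf.expectation (arrivals_pmf n k) (social_cost S)"

end

theory Submission
  imports Defs
begin

text \<open>
  The bound holds for every matching set \<open>P\<close> separately. Write \<open>\<mu>\<close> for the expected optimum.
  A Type I selection covering \<open>d\<close> of \<open>r\<close> uncovered tasks costs at most \<open>64 \<mu> d / r\<close>, so these
  selections cost \<open>64 \<mu> H\<^sub>n\<close> altogether. When a Type II selection of bid \<open>b\<close> is made with
  uncovered set \<open>U\<close>, every pair meeting \<open>U\<close> costs at least \<open>b\<close> and covers a fraction of \<open>U\<close> that
  is small relative to its cost. Let \<open>\<nu> b\<close> be the expected number of pairs of cost at least \<open>b\<close> in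
  an optimal cover. With probability at least \<open>1/2\<close> the arrivals in \<open>U\<close> are covered by
  \<open>4 \<nu> b\<close> such pairs of total cost at most \<open>4 \<mu>\<close>, hence covering at most \<open>1/16\<close> of \<open>U\<close>; a union
  bound over all such subfamilies of \<open>P\<close> gives \<open>k |U| / n = O(\<nu> b * ln l)\<close>. The bids of Type II
  selections are nondecreasing, so summation by parts bounds their expected cost by
  \<open>O(ln l) * \<integral>\<nu>(b) db = O(\<mu> ln l)\<close>. Bounding \<open>\<nu> b\<close> by \<open>\<mu> / b\<close> instead would lose another
  logarithm.
\<close>

section \<open>Harmonic numbers and the count of small subfamilies\<close>

lemma harm_le_ln:
  assumes "n \<ge> 1"
  shows "(harm n :: real) \<le> 1 + ln (real n)"
proof -
  obtain m where m: "n = Suc m" using assms by (cases n) auto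
  have "harm (Suc m) - ln (real (Suc m)) \<le> harm (Suc 0) - ln (real (Suc 0))"
    using decseqD[OF decseq_harm_diff_ln, of 0 m] by simp
  then show ?thesis using m by (simp add: harm_expand)
qed

text \<open>Each of the \<open>d\<close> summands of the difference is at least
  \<open>1 / (a + d)\<close>. With \<open>a + d\<close> uncovered tasks, \<open>d\<close> of them
  newly covered, this makes the charges of Type I selections telescope.\<close>

lemma harm_diff_ge:
  "real d / real (a + d) \<le> harm (a + d) - harm a"
proof (cases "a + d = 0")
  case False
  have "harm a + real j / real (a + d) \<le> harm (a + j)" if "j \<le> d" for j
    using that
  proof (induction j)
    case (Suc j)
    have "1 / real (a + d) \<le> 1 / real (Suc (a + j))"
      using Suc.prems by (intro divide_left_mono) auto
    then show ?case
      using Suc by (simp add: harm_Suc add_divide_distrib inverse_eq_divide)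
  qed auto
  from this[of d] show ?thesis by simp
qed auto

text \<open>Sizes up to \<open>r\<close> and size exactly \<open>r + 1\<close> contribute at most
  \<open>l ^ (r + 1)\<close> each. The resulting factor 2 is absorbed by one more factor
  \<open>l\<close>, which is why the exponent exceeds the size bound by one.\<close>

lemma card_subsets_card_le:
  assumes "finite P" and "card P \<le> l" and "l \<ge> 2"
  shows "card {Q. Q \<subseteq> P \<and> card Q \<le> r} \<le> l ^ (r + 1)"
proof (induction r)
  case 0
  have "{Q. Q \<subseteq> P \<and> card Q \<le> 0} = {{}}"
    using assms(1) finite_subset by fastforce
  then show ?case using assms by simp
next
  case (Suc r)
  have "{Q. Q \<subseteq> P \<and> card Q \<le> Suc r} = {Q. Q \<subseteq> P \<and> card Q \<le> r} \<union> {Q. Q \<subseteq> P \<and> card Q = Suc r}"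
    by auto
  then have "card {Q. Q \<subseteq> P \<and> card Q \<le> Suc r} \<le>
      card {Q. Q \<subseteq> P \<and> card Q \<le> r} + card {Q. Q \<subseteq> P \<and> card Q = Suc r}"
    by (simp only: card_Un_le)
  moreover have "card {Q. Q \<subseteq> P \<and> card Q = Suc r} \<le> l ^ Suc r"
  proof (cases "Suc r \<le> card P")
    case True
    have "card P choose Suc r \<le> card P ^ Suc r" using True by (rule binomial_le_pow)
    also have "\<dots> \<le> l ^ Suc r" using assms(2) by (intro power_mono) auto
    finally show ?thesis using assms(1) by (simp add: n_subsets)
  next
    case False
    then show ?thesis using assms(1) by (simp add: n_subsets binomial_eq_0)
  qed
  ultimately have "card {Q. Q \<subseteq> P \<and> card Q \<le> Suc r} \<le> 2 * l ^ Suc r"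
    using Suc by simp
  also have "\<dots> \<le> l * l ^ Suc r" using assms(3) by (intro mult_right_mono) auto
  finally show ?case by simp
qed

section \<open>Hitting and missing probabilities of uniform arrivals\<close>

lemma prob_replicate_pmf_subset:
  fixes p :: "'a::countable pmf"
  shows "measure_pmf.prob (replicate_pmf k p) {xs. set xs \<subseteq> V} = measure_pmf.prob p V ^ k"
proof (induction k)
  case (Suc k)
  have "replicate_pmf (Suc k) p = map_pmf (\<lambda>(x, xs). x # xs) (pair_pmf p (replicate_pmf k p))"
    by (simp add: pair_pmf_def map_bind_pmf)
  then have "measure_pmf.prob (replicate_pmf (Suc k) p) {xs. set xs \<subseteq> V} =
      measure_pmf.prob (pair_pmf p (replicate_pmf k p)) ((\<lambda>(x, xs). x # xs) -` {xs. set xs \<subseteq> V})"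
    by simp
  also have "(\<lambda>(x, xs). x # xs) -` {xs. set xs \<subseteq> V} = V \<times> {xs. set xs \<subseteq> V}"
    by auto
  also have "measure_pmf.prob (pair_pmf p (replicate_pmf k p)) \<dots> =
      measure_pmf.prob p V * measure_pmf.prob (replicate_pmf k p) {xs. set xs \<subseteq> V}"
    by (rule measure_pmf_prob_product) auto
  finally show ?case using Suc by simp
qed auto

lemma prob_arrivals_subset:
  assumes "n \<ge> 1"
  shows "measure_pmf.prob (arrivals_pmf n k) {A. set_mset A \<subseteq> V} =
    (real (card ({1..n} \<inter> V)) / real n) ^ k"
proof -
  have "measure_pmf.prob (arrivals_pmf n k) {A. set_mset A \<subseteq> V} =
      measure_pmf.prob (replicate_pmf k (pmf_of_set {1..n})) {xs. set xs \<subseteq> V}"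
    by (simp add: arrivals_pmf_def vimage_def)
  then show ?thesis
    using assms by (simp add: prob_replicate_pmf_subset measure_pmf_of_set)
qed

lemma set_arrivals_pmf:
  assumes "n \<ge> 1"
  shows "set_pmf (arrivals_pmf n k) = mset ` {xs. set xs \<subseteq> {1..n} \<and> length xs = k}"
  using assms by (auto simp: arrivals_pmf_def set_replicate_pmf set_pmf_of_set lists_eq_set)

lemma finite_set_arrivals_pmf:
  assumes "n \<ge> 1"
  shows "finite (set_pmf (arrivals_pmf n k))"
  using assms by (simp add: set_arrivals_pmf finite_lists_length_eq)

lemma prob_arrivals_miss:
  assumes "n \<ge> 1" and "D \<subseteq> {1..n}"
  shows "measure_pmf.prob (arrivals_pmf n k) {A. set_mset A \<inter> D = {}} =
    (1 - real (card D) / real n) ^ k"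
proof -
  have "finite D" using assms(2) by (rule finite_subset) simp
  have "card D \<le> n" using card_mono[OF _ assms(2)] by simp
  have "{1..n} \<inter> - D = {1..n} - D" by auto
  then have "card ({1..n} \<inter> - D) = n - card D"
    using assms(2) \<open>finite D\<close> by (simp add: card_Diff_subset)
  moreover have "{A. set_mset A \<inter> D = {}} = {A. set_mset A \<subseteq> - D}" by auto
  ultimately show ?thesis
    using assms(1) \<open>card D \<le> n\<close> by (simp add: prob_arrivals_subset of_nat_diff diff_divide_distrib)
qed

lemma prob_arrivals_miss_le:
  assumes "n \<ge> 1" and "D \<subseteq> {1..n}"
  shows "measure_pmf.prob (arrivals_pmf n k) {A. set_mset A \<inter> D = {}} \<le>
    exp (- (real k * (real (card D) / real n)))"
proof -
  have "card D \<le> n" using card_mono[OF _ assms(2)] by simp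
  then have "(1 - real (card D) / real n) ^ k \<le> exp (- (real (card D) / real n)) ^ k"
    using assms(1) exp_ge_add_one_self[of "- (real (card D) / real n)"]
    by (intro power_mono) auto
  also have "\<dots> = exp (- (real k * (real (card D) / real n)))"
    by (metis exp_of_nat_mult mult_minus_right)
  finally show ?thesis using prob_arrivals_miss[OF assms] by simp
qed

text \<open>The union bound over the \<open>k\<close> draws, obtained from Bernoulli's
  inequality.\<close>

lemma prob_arrivals_hit_le:
  assumes "n \<ge> 1" and "D \<subseteq> {1..n}"
  shows "measure_pmf.prob (arrivals_pmf n k) {A. set_mset A \<inter> D \<noteq> {}} \<le>
    real k * (real (card D) / real n)"
proof -
  have "card D \<le> n" using card_mono[OF _ assms(2)] by simp
  have "measure_pmf.prob (arrivals_pmf n k) {A. set_mset A \<inter> D \<noteq> {}} =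
      1 - measure_pmf.prob (arrivals_pmf n k) {A. set_mset A \<inter> D = {}}"
    by (rule measure_pmf.prob_neg[where P = "\<lambda>A. set_mset A \<inter> D = {}", simplified])
  moreover have "1 + real k * (- (real (card D) / real n)) \<le> (1 + (- (real (card D) / real n))) ^ k"
    using assms(1) \<open>card D \<le> n\<close> by (intro Bernoulli_inequality) (simp add: divide_le_eq)
  ultimately show ?thesis using prob_arrivals_miss[OF assms, of k] by simp
qed


section \<open>Social cost read off the log of a run\<close>

lemma herald_run_selected:
  "herald_run T P U S \<Longrightarrow> (p, V) \<in> set S \<Longrightarrow> p \<in> P"
  by (induction rule: herald_run.induct) (auto simp: may_select_def split: if_splits)

text \<open>\<open>winners\<close> is a set, so a pair counts once on the left however often it is
  logged; nonnegative costs make the sum over the log an upper bound. Finiteness is carried along so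
  that a new winner can be split off the sum.\<close>

lemma social_cost_le_sum_list:
  assumes "\<And>p V. (p, V) \<in> set S \<Longrightarrow> 0 \<le> snd p"
  shows "finite (winners S A) \<and> social_cost S A \<le>
    (\<Sum>(p, V)\<leftarrow>S. snd p * indicator {A. set_mset A \<inter> (fst p \<inter> V) \<noteq> {}} A)"
  using assms
proof (induction S)
  case Nil
  then show ?case by (simp add: winners_def social_cost_def)
next
  case (Cons e S)
  obtain p V where e: "e = (p, V)" by fastforce
  have IH: "finite (winners S A)" "social_cost S A \<le>
      (\<Sum>(p, V)\<leftarrow>S. snd p * indicator {A. set_mset A \<inter> (fst p \<inter> V) \<noteq> {}} A)"
    using Cons.IH Cons.prems by auto
  have "0 \<le> snd p" using Cons.prems[of p V] e by simp
  show ?case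
  proof (cases "set_mset A \<inter> (fst p \<inter> V) \<noteq> {}")
    case True
    then have w: "winners (e # S) A = insert p (winners S A)"
      by (auto simp: winners_def e)
    have "social_cost (e # S) A \<le> snd p + social_cost S A"
      using IH(1) \<open>0 \<le> snd p\<close> unfolding social_cost_def w
      by (cases "p \<in> winners S A") (auto simp: insert_absorb)
    then show ?thesis using IH w True by (simp add: e)
  next
    case False
    then have "winners (e # S) A = winners S A"
      by (auto simp: winners_def e)
    then show ?thesis using IH False by (simp add: e social_cost_def)
  qed
qed

section \<open>Optimal covers for one fixed matching set\<close>

text \<open>These are properties shared by all matching sets in the support. The size of
  \<open>P\<close> is only bounded by \<open>l\<close>, since two indices with equal subset and
  equal bid yield a single pair.\<close>

locale covered_arrivals =
  fixes n k l :: nat and P :: "matching_pair set"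
  assumes n_ge: "n \<ge> 1" and k_ge: "k \<ge> 1" and l_ge: "l \<ge> 2"
    and finite_P: "finite P" and card_P: "card P \<le> l"
    and cost_pos: "\<And>p. p \<in> P \<Longrightarrow> 0 < snd p"
    and covers: "{1..n} \<subseteq> (\<Union>p\<in>P. fst p)"
begin

abbreviation "arr \<equiv> arrivals_pmf n k"
abbreviation "prob \<equiv> measure_pmf.prob arr"
abbreviation "expect \<equiv> measure_pmf.expectation arr"
abbreviation "\<mu> \<equiv> expected_opt n k P"

text \<open>\<open>opt_cost\<close> is only a value. Fixing one minimiser per arrival multiset
  allows its expensive pairs to be counted in expectation.\<close>

definition opt_cover :: "nat multiset \<Rightarrow> matching_pair set" where
  "opt_cover A = (SOME Q. Q \<subseteq> P \<and> set_mset A \<subseteq> (\<Union>p\<in>Q. fst p) \<and> sum snd Q = opt_cost P A)"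

lemma integrable_arr [simp]: "integrable arr (f :: _ \<Rightarrow> real)"
  by (intro integrable_measure_pmf_finite finite_set_arrivals_pmf n_ge)

lemma prob_mono:
  assumes "\<And>A. A \<in> set_pmf arr \<Longrightarrow> A \<in> X \<Longrightarrow> A \<in> Y"
  shows "prob X \<le> prob Y"
  using assms by (intro measure_pmf.finite_measure_mono_AE) (auto simp: AE_measure_pmf_iff)

lemma expect_mono:
  fixes f g :: "nat multiset \<Rightarrow> real"
  assumes "\<And>A. A \<in> set_pmf arr \<Longrightarrow> f A \<le> g A"
  shows "expect f \<le> expect g"
  using assms by (intro integral_mono_AE) (auto simp: AE_measure_pmf_iff)

lemma prob_eq_expect: "prob X = expect (indicator X)"
  by simp

lemma arrD:
  assumes "A \<in> set_pmf arr"
  shows "set_mset A \<subseteq> {1..n}" and "A \<noteq> {#}"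
  using assms k_ge by (auto simp: set_arrivals_pmf[OF n_ge])

text \<open>On the support \<open>P\<close> itself is a cover, so the minimum ranges over a finite
  nonempty set and is attained.\<close>

lemma opt_cover:
  assumes "A \<in> set_pmf arr"
  shows "opt_cover A \<subseteq> P" and "set_mset A \<subseteq> (\<Union>p\<in>opt_cover A. fst p)"
    and "sum snd (opt_cover A) = opt_cost P A"
proof -
  let ?X = "{\<Sum>p\<in>Q. snd p | Q. Q \<subseteq> P \<and> set_mset A \<subseteq> (\<Union>p\<in>Q. fst p)}"
  have "?X \<subseteq> sum snd ` Pow P" by auto
  then have "finite ?X" by (rule finite_subset) (use finite_P in simp)
  moreover have "set_mset A \<subseteq> (\<Union>p\<in>P. fst p)" using arrD(1)[OF assms] covers by blast
  then have "?X \<noteq> {}" by blast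
  ultimately have "Min ?X \<in> ?X" by (rule Min_in)
  then have "\<exists>Q. Q \<subseteq> P \<and> set_mset A \<subseteq> (\<Union>p\<in>Q. fst p) \<and> sum snd Q = opt_cost P A"
    unfolding opt_cost_def[symmetric] by auto
  from someI_ex[OF this] show "opt_cover A \<subseteq> P" and "set_mset A \<subseteq> (\<Union>p\<in>opt_cover A. fst p)"
    and "sum snd (opt_cover A) = opt_cost P A"
    unfolding opt_cover_def by blast+
qed

lemma finite_opt_cover: "A \<in> set_pmf arr \<Longrightarrow> finite (opt_cover A)"
  using opt_cover(1) finite_P by (rule finite_subset)

lemma opt_cover_cost_pos:
  assumes "A \<in> set_pmf arr" and "p \<in> opt_cover A"
  shows "0 < snd p"
  using opt_cover(1)[OF assms(1)] assms(2) cost_pos by blast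

lemma opt_cost_pos:
  assumes "A \<in> set_pmf arr"
  shows "0 < opt_cost P A"
proof -
  have "opt_cover A \<noteq> {}" using opt_cover(2)[OF assms] arrD(2)[OF assms] by auto
  then have "0 < sum snd (opt_cover A)"
    using opt_cover_cost_pos[OF assms] by (intro sum_pos finite_opt_cover assms) auto
  then show ?thesis by (simp add: opt_cover(3)[OF assms])
qed

text \<open>The support is finite, so the expectation is bounded below by the least optimum on it,
  which is positive.\<close>

lemma expected_opt_pos: "0 < \<mu>"
proof -
  have fin: "finite (opt_cost P ` set_pmf arr)"
    using finite_set_arrivals_pmf[OF n_ge] by simp
  have "Min (opt_cost P ` set_pmf arr) \<in> opt_cost P ` set_pmf arr"
    using fin by (intro Min_in) (auto simp: set_pmf_not_empty)
  then have "0 < Min (opt_cost P ` set_pmf arr)"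
    using opt_cost_pos by auto
  also have "\<dots> \<le> \<mu>"
    unfolding expected_opt_def using fin
    by (intro measure_pmf.integral_ge_const) (auto simp: AE_measure_pmf_iff)
  finally show ?thesis .
qed

section \<open>Arrivals among the tasks uncovered at a Type II selection\<close>

text \<open>
  For small \<open>\<nu>\<close> the rounding in the union bound is too lossy; there the arrivals miss \<open>U\<close> with
  probability at least \<open>1 - \<nu>\<close> already.
\<close>

lemma uncovered_le:
  assumes U: "U \<subseteq> {1..n}" "U \<noteq> {}"
    and sparse: "\<And>p. p \<in> P \<Longrightarrow> fst p \<inter> U \<noteq> {} \<Longrightarrow>
      c \<le> snd p \<and> 64 * \<mu> * real (card (fst p \<inter> U)) \<le> snd p * real (card U)"
  shows "real k * (real (card U) / real n) \<le>
    22 * ln (real l) * expect (\<lambda>A. real (card {p \<in> opt_cover A. c \<le> snd p}))"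
proof -
  define N where "N A = real (card {p \<in> opt_cover A. c \<le> snd p})" for A
  define R where "R A = {p \<in> opt_cover A. fst p \<inter> U \<noteq> {}}" for A
  define \<nu> where "\<nu> = expect N"
  define x where "x = real k * (real (card U) / real n)"
  have "finite U" using U(1) by (rule finite_subset) simp
  have "x \<ge> 0" by (simp add: x_def)
  have N_nonneg: "N A \<ge> 0" for A by (simp add: N_def)
  then have "\<nu> \<ge> 0" unfolding \<nu>_def by (rule Bochner_Integration.integral_nonneg)
  have R: "R A \<subseteq> P" "real (card (R A)) \<le> N A" "sum snd (R A) \<le> opt_cost P A"
    "set_mset A \<inter> U \<subseteq> (\<Union>p\<in>R A. fst p)" if A: "A \<in> set_pmf arr" for A
  proof -
    note [simp] = finite_opt_cover[OF A]
    show "R A \<subseteq> P" using opt_cover(1)[OF A] by (auto simp: R_def)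
    have "R A \<subseteq> {p \<in> opt_cover A. c \<le> snd p}"
      using sparse opt_cover(1)[OF A] by (auto simp: R_def)
    then show "real (card (R A)) \<le> N A"
      unfolding N_def by (intro of_nat_mono card_mono) auto
    have "sum snd (R A) \<le> sum snd (opt_cover A)"
      using opt_cover_cost_pos[OF A] by (intro sum_mono2) (auto simp: R_def intro: less_imp_le)
    then show "sum snd (R A) \<le> opt_cost P A" by (simp add: opt_cover(3)[OF A])
    show "set_mset A \<inter> U \<subseteq> (\<Union>p\<in>R A. fst p)"
      using opt_cover(2)[OF A] unfolding R_def by blast
  qed
  have ln_l: "ln 2 \<le> ln (real l)" "2 / 3 \<le> ln (real l)"
    using l_ge ln2_ge_two_thirds by (auto intro: order_trans)
  have "x \<le> 22 * ln (real l) * \<nu>"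
  proof (cases "\<nu> \<le> 1 / 8")
    case True
    \<comment> \<open>An arrival in \<open>U\<close> forces a pair into \<open>R A\<close>, so the
      indicator of a hit is at most \<open>N A\<close>.\<close>
    have "prob {A. set_mset A \<inter> U \<noteq> {}} \<le> \<nu>"
      unfolding \<nu>_def prob_eq_expect
    proof (rule expect_mono)
      fix A assume A: "A \<in> set_pmf arr"
      have "1 \<le> N A" if "set_mset A \<inter> U \<noteq> {}"
      proof -
        have "R A \<noteq> {}" using R(4)[OF A] that by auto
        then have "1 \<le> card (R A)"
          using R(1)[OF A] finite_P by (simp add: Suc_le_eq card_gt_0_iff finite_subset)
        then show ?thesis using R(2)[OF A] by linarith
      qed
      then show "indicator {A. set_mset A \<inter> U \<noteq> {}} A \<le> N A"
        by (auto simp: N_def indicator_def)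
    qed
    moreover have "prob {A. set_mset A \<inter> U \<noteq> {}} = 1 - prob {A. set_mset A \<inter> U = {}}"
      by (rule measure_pmf.prob_neg[where P = "\<lambda>A. set_mset A \<inter> U = {}", simplified])
    ultimately have "1 - \<nu> \<le> exp (- x)"
      using prob_arrivals_miss_le[OF n_ge U(1), of k] by (simp add: x_def)
    \<comment> \<open>Multiplying by \<open>1 + x \<le> exp x\<close> turns the exponential bound
      into a linear inequality in \<open>x\<close>.\<close>
    then have "(1 - \<nu>) * (1 + x) \<le> exp (- x) * exp x"
      using \<open>x \<ge> 0\<close> True exp_ge_add_one_self[of x] by (intro mult_mono) auto
    then have "x \<le> \<nu> + \<nu> * x" by (simp add: exp_minus algebra_simps)
    also have "\<nu> * x \<le> 1 / 8 * x" using True \<open>x \<ge> 0\<close> by (rule mult_right_mono)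
    finally have "x \<le> 8 / 7 * \<nu>" by simp
    also have "\<dots> \<le> 22 * ln (real l) * \<nu>"
      using ln_l \<open>\<nu> \<ge> 0\<close> by (intro mult_right_mono) auto
    finally show ?thesis .
  next
    case False
    \<comment> \<open>The factors 4 are the Markov thresholds used below. \<open>F\<close> contains
      \<open>R A\<close> for every \<open>A\<close> below both thresholds, yet does not depend on
      \<open>A\<close>, so a union bound over it is possible.\<close>
    define r where "r = nat \<lfloor>4 * \<nu>\<rfloor>"
    define F where "F = {Q. Q \<subseteq> P \<and> card Q \<le> r \<and> sum snd Q \<le> 4 * \<mu> \<and> (\<forall>q\<in>Q. fst q \<inter> U \<noteq> {})}"
    have r: "real r \<le> 4 * \<nu>" using \<open>\<nu> \<ge> 0\<close> by (simp add: r_def)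
    have "F \<subseteq> {Q. Q \<subseteq> P \<and> card Q \<le> r}" by (auto simp: F_def)
    then have "finite F" "card F \<le> l ^ (r + 1)"
      using finite_P card_mono[of "{Q. Q \<subseteq> P \<and> card Q \<le> r}" F]
        card_subsets_card_le[OF finite_P card_P l_ge, of r]
      by (auto intro: finite_subset)
    \<comment> \<open>The 64 of the selection threshold enters here: pairs of total cost at most
      \<open>4 * \<mu>\<close> cover at most \<open>4 / 64 = 1 / 16\<close> of \<open>U\<close>, so
      the arrivals must miss at least \<open>15 / 16\<close> of it.\<close>
    have each: "prob {A. set_mset A \<inter> (U - (\<Union>q\<in>Q. fst q)) = {}} \<le> exp (- (15 / 16 * x))"
      if Q: "Q \<in> F" for Q
    proof -
      let ?D = "U - (\<Union>q\<in>Q. fst q)"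
      have Q': "Q \<subseteq> P" "finite Q" "sum snd Q \<le> 4 * \<mu>" "\<And>q. q \<in> Q \<Longrightarrow> fst q \<inter> U \<noteq> {}"
        using Q finite_P finite_subset by (auto simp: F_def)
      have "U = ?D \<union> (\<Union>q\<in>Q. fst q \<inter> U)" by auto
      then have "card U \<le> card ?D + card (\<Union>q\<in>Q. fst q \<inter> U)"
        by (metis card_Un_le)
      also have "card (\<Union>q\<in>Q. fst q \<inter> U) \<le> (\<Sum>q\<in>Q. card (fst q \<inter> U))"
        by (intro card_UN_le Q')
      finally have "real (card U) \<le> real (card ?D) + (\<Sum>q\<in>Q. real (card (fst q \<inter> U)))"
        by (simp flip: of_nat_sum of_nat_add)
      also have "(\<Sum>q\<in>Q. real (card (fst q \<inter> U))) \<le> (\<Sum>q\<in>Q. snd q * (real (card U) / (64 * \<mu>)))"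
        using sparse Q' expected_opt_pos by (intro sum_mono) (auto simp: field_simps subset_iff)
      also have "\<dots> = sum snd Q * (real (card U) / (64 * \<mu>))"
        by (rule sum_distrib_right[symmetric])
      also have "\<dots> \<le> 4 * \<mu> * (real (card U) / (64 * \<mu>))"
        using Q'(3) expected_opt_pos by (intro mult_right_mono) auto
      also have "\<dots> = real (card U) / 16" using expected_opt_pos by simp
      finally have D: "15 / 16 * real (card U) \<le> real (card ?D)" by simp
      have "15 / 16 * x = real k * (15 / 16 * real (card U) / real n)" by (simp add: x_def)
      also have "\<dots> \<le> real k * (real (card ?D) / real n)"
        using D by (intro mult_left_mono divide_right_mono) auto
      finally have "exp (- (real k * (real (card ?D) / real n))) \<le> exp (- (15 / 16 * x))" by simp
      moreover have "?D \<subseteq> {1..n}" using U(1) by auto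
      ultimately show ?thesis using prob_arrivals_miss_le[OF n_ge, of ?D k] by linarith
    qed
    have "prob {A. N A \<ge> 4 * \<nu>} \<le> \<nu> / (4 * \<nu>)"
      using integral_Markov_inequality_measure[of arr N UNIV "4 * \<nu>"] False
      by (simp add: \<nu>_def[symmetric] N_nonneg)
    then have N: "prob {A. N A \<ge> 4 * \<nu>} \<le> 1 / 4" using False by simp
    have "prob {A. opt_cost P A \<ge> 4 * \<mu>} \<le> \<mu> / (4 * \<mu>)"
      using integral_Markov_inequality_measure[of arr "opt_cost P" UNIV "4 * \<mu>"] expected_opt_pos
        opt_cost_pos
      by (simp add: expected_opt_def AE_measure_pmf_iff less_imp_le)
    then have O: "prob {A. opt_cost P A \<ge> 4 * \<mu>} \<le> 1 / 4" using expected_opt_pos by simp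
    \<comment> \<open>Each bad event has probability at most \<open>1/4\<close>, which leaves at
      least \<open>1/2\<close> for the good event.\<close>
    have "{A. N A \<ge> 4 * \<nu>} \<union> {A. opt_cost P A \<ge> 4 * \<mu>} \<union>
        {A. N A < 4 * \<nu> \<and> opt_cost P A < 4 * \<mu>} = UNIV"
      by auto
    then have "1 = prob ({A. N A \<ge> 4 * \<nu>} \<union> {A. opt_cost P A \<ge> 4 * \<mu>} \<union>
        {A. N A < 4 * \<nu> \<and> opt_cost P A < 4 * \<mu>})"
      by simp
    also have "\<dots> \<le> prob {A. N A \<ge> 4 * \<nu>} + prob {A. opt_cost P A \<ge> 4 * \<mu>} +
        prob {A. N A < 4 * \<nu> \<and> opt_cost P A < 4 * \<mu>}"
      by (intro order_trans[OF measure_Un_le] add_right_mono measure_Un_le) auto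
    also have "prob {A. N A < 4 * \<nu> \<and> opt_cost P A < 4 * \<mu>} \<le>
        prob (\<Union>Q\<in>F. {A. set_mset A \<inter> (U - (\<Union>q\<in>Q. fst q)) = {}})"
    proof (rule prob_mono)
      fix A assume A: "A \<in> set_pmf arr" and "A \<in> {A. N A < 4 * \<nu> \<and> opt_cost P A < 4 * \<mu>}"
      then have good: "N A < 4 * \<nu>" "opt_cost P A < 4 * \<mu>" by auto
      have "card (R A) \<le> r"
        unfolding r_def using R(2)[OF A] good(1) by linarith
      then have "R A \<in> F"
        using R(1,3)[OF A] good(2) by (auto simp: F_def R_def)
      moreover have "set_mset A \<inter> (U - (\<Union>q\<in>R A. fst q)) = {}" using R(4)[OF A] by auto
      ultimately show "A \<in> (\<Union>Q\<in>F. {A. set_mset A \<inter> (U - (\<Union>q\<in>Q. fst q)) = {}})" by blast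
    qed
    also have "\<dots> \<le> (\<Sum>Q\<in>F. prob {A. set_mset A \<inter> (U - (\<Union>q\<in>Q. fst q)) = {}})"
      by (intro measure_pmf.finite_measure_subadditive_finite \<open>finite F\<close>) auto
    also have "\<dots> \<le> real (card F) * exp (- (15 / 16 * x))"
      using each by (rule sum_bounded_above)
    also have "\<dots> \<le> real (l ^ (r + 1)) * exp (- (15 / 16 * x))"
      using \<open>card F \<le> l ^ (r + 1)\<close> by (intro mult_right_mono of_nat_mono) auto
    finally have "1 \<le> 2 * (real l ^ (r + 1) * exp (- (15 / 16 * x)))" using N O by simp
    then have "0 \<le> ln (2 * (real l ^ (r + 1) * exp (- (15 / 16 * x))))"
      by (rule ln_ge_zero)
    also have "\<dots> = ln 2 + (real (r + 1) * ln (real l) - 15 / 16 * x)"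
      using l_ge by (simp add: ln_mult ln_realpow del: power_Suc)
    finally have "15 / 16 * x \<le> ln 2 + real (r + 1) * ln (real l)" by simp
    \<comment> \<open>Now \<open>\<nu> > 1/8\<close> absorbs the additive terms:
      \<open>1 \<le> 8 * \<nu>\<close>, and \<open>r + 1 \<le> 4 * \<nu> + 8 * \<nu>\<close>.
      Dividing the total factor 20 by \<open>15/16\<close> gives \<open>64/3\<close>, rounded up to
      22.\<close>
    also have "\<dots> \<le> 8 * \<nu> * ln (real l) + 12 * \<nu> * ln (real l)"
    proof (rule add_mono)
      have "1 * ln (real l) \<le> 8 * \<nu> * ln (real l)"
        using False ln_l(2) by (intro mult_right_mono) auto
      then show "ln 2 \<le> 8 * \<nu> * ln (real l)" using ln_l(1) by simp
      show "real (r + 1) * ln (real l) \<le> 12 * \<nu> * ln (real l)"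
        using False ln_l(2) r by (intro mult_right_mono) auto
    qed
    finally have "x \<le> 64 / 3 * (\<nu> * ln (real l))" by simp
    also have "\<dots> \<le> 22 * (\<nu> * ln (real l))"
      using ln_l(2) \<open>\<nu> \<ge> 0\<close> by (intro mult_right_mono) auto
    finally show ?thesis by (simp add: mult_ac)
  qed
  then show ?thesis by (simp only: x_def \<nu>_def N_def[abs_def])
qed

section \<open>Induction along a run\<close>

text \<open>
  The parameter \<open>a\<close> is a lower bound on the bids still in play. It is raised to the selected bid at
  each Type II selection, which carries out the summation by parts inside the induction.
\<close>

lemma herald_run_bound:
  assumes "herald_run (64 * \<mu>) P' U S" and "U \<subseteq> {1..n}" and "P' \<subseteq> P"
    and "\<And>p. p \<in> P \<Longrightarrow> fst p \<inter> U \<noteq> {} \<Longrightarrow> p \<in> P' \<and> a \<le> snd p" and "0 \<le> a"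
  shows "(\<Sum>(p, V)\<leftarrow>S. snd p * prob {A. set_mset A \<inter> (fst p \<inter> V) \<noteq> {}}) \<le>
    64 * \<mu> * harm (card U) + a * (real k * (real (card U) / real n)) +
    22 * ln (real l) * expect (\<lambda>A. \<Sum>p\<in>opt_cover A. max 0 (snd p - a))"
  using assms
proof (induction arbitrary: a rule: herald_run.induct)
  case (stop P')
  have "0 \<le> expect (\<lambda>A. \<Sum>p\<in>opt_cover A. max 0 (snd p - a))"
    by (intro Bochner_Integration.integral_nonneg sum_nonneg) simp
  then show ?case using l_ge by (simp add: harm_expand)
next
  case (step U P' p S)
  define d where "d = card (fst p \<inter> U)"
  define cost where "cost S = (\<Sum>(p, V)\<leftarrow>S. snd p * prob {A. set_mset A \<inter> (fst p \<inter> V) \<noteq> {}})" for S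
  define excess where "excess b = expect (\<lambda>A. \<Sum>p\<in>opt_cover A. max 0 (snd p - b))" for b
  have "finite U" using step.prems(1) by (rule finite_subset) simp
  have "U = (U - fst p) \<union> (fst p \<inter> U)" by auto
  then have "card U = card ((U - fst p) \<union> (fst p \<inter> U))" by simp
  also have "\<dots> = card (U - fst p) + d"
    unfolding d_def using \<open>finite U\<close> by (intro card_Un_disjoint) auto
  finally have card_U: "card U = card (U - fst p) + d" .
  have "card U > 0" using \<open>finite U\<close> step.hyps(1) by (simp add: card_gt_0_iff)
  have "p \<in> P'" using step.hyps(2) by (auto simp: may_select_def split: if_splits)
  then have "p \<in> P" using step.prems(2) by auto
  note pos = cost_pos[OF this]
  have cost: "cost ((p, U) # S) = snd p * prob {A. set_mset A \<inter> (fst p \<inter> U) \<noteq> {}} + cost S"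
    by (simp add: cost_def)
  have IH: "cost S \<le> 64 * \<mu> * harm (card (U - fst p)) +
      b * (real k * (real (card (U - fst p)) / real n)) + 22 * ln (real l) * excess b"
    if "\<And>q. q \<in> P \<Longrightarrow> fst q \<inter> U \<noteq> {} \<Longrightarrow> b \<le> snd q" "0 \<le> b" for b
    unfolding cost_def excess_def
  proof (rule step.IH)
    \<comment> \<open>The removed pair \<open>p\<close> has no task in \<open>U - fst p\<close>.
      Hence every pair of \<open>P\<close> that still meets the uncovered set stays available, and
      the selection rule compares against all of them.\<close>
    show "q \<in> P' - {p} \<and> b \<le> snd q" if "q \<in> P" "fst q \<inter> (U - fst p) \<noteq> {}" for q
      using that step.prems(3)[of q] \<open>\<And>q. q \<in> P \<Longrightarrow> fst q \<inter> U \<noteq> {} \<Longrightarrow> b \<le> snd q\<close>[of q]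
      by auto
  qed (use step.prems \<open>0 \<le> b\<close> in auto)
  have "cost ((p, U) # S) \<le> 64 * \<mu> * harm (card U) + a * (real k * (real (card U) / real n)) +
    22 * ln (real l) * excess a"
  proof (cases "\<exists>q\<in>P'. cost_effectiveness U q \<le> ereal (64 * \<mu> / real (card U))")
    case True
    \<comment> \<open>A Type I selection is paid in full by the drop of the harmonic term, with its
      probability of being used bounded by 1. The bound \<open>a\<close> is kept.\<close>
    then have "cost_effectiveness U p \<le> ereal (64 * \<mu> / real (card U))"
      using step.hyps(2) by (auto simp: may_select_def intro: order_trans)
    then have "fst p \<inter> U \<noteq> {}" "snd p / real d \<le> 64 * \<mu> / real (card U)"
      by (auto simp: cost_effectiveness_def d_def split: if_splits)
    moreover from this have "d > 0" using \<open>finite U\<close> by (simp add: d_def card_gt_0_iff)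
    ultimately have "snd p \<le> 64 * \<mu> * (real d / real (card U))"
      by (simp add: divide_le_eq)
    also have "\<dots> \<le> 64 * \<mu> * (harm (card U) - harm (card (U - fst p)))"
      using harm_diff_ge[of d "card (U - fst p)"] expected_opt_pos
      by (intro mult_left_mono) (auto simp: card_U)
    finally have "snd p \<le> 64 * \<mu> * harm (card U) - 64 * \<mu> * harm (card (U - fst p))"
      by (simp add: right_diff_distrib)
    moreover have "snd p * prob {A. set_mset A \<inter> (fst p \<inter> U) \<noteq> {}} \<le> snd p * 1"
      using pos by (intro mult_left_mono) auto
    moreover have "a * (real k * (real (card (U - fst p)) / real n)) \<le>
        a * (real k * (real (card U) / real n))"
      using step.prems(4) by (intro mult_left_mono divide_right_mono) (auto simp: card_U)
    ultimately show ?thesis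
      using IH[of a] step.prems(3,4) unfolding cost by fastforce
  next
    case False
    define c where "c = snd p"
    have p: "fst p \<inter> U \<noteq> {}" "\<And>q. q \<in> P' \<Longrightarrow> fst q \<inter> U \<noteq> {} \<Longrightarrow> c \<le> snd q"
      using step.hyps(2) False by (auto simp: may_select_def c_def)
    have "a \<le> c" using step.prems(3)[OF \<open>p \<in> P\<close> p(1)] by (simp add: c_def)
    define x where "x = real k * (real (card U) / real n)"
    define \<nu> where "\<nu> = expect (\<lambda>A. real (card {q \<in> opt_cover A. c \<le> snd q}))"
    have x: "x \<le> 22 * ln (real l) * \<nu>"
      unfolding x_def \<nu>_def
    proof (rule uncovered_le[OF step.prems(1) step.hyps(1)])
      fix q assume q: "q \<in> P" "fst q \<inter> U \<noteq> {}"
      then have "q \<in> P'" using step.prems(3) by blast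
      have "\<not> cost_effectiveness U q \<le> ereal (64 * \<mu> / real (card U))"
        using False \<open>q \<in> P'\<close> by blast
      then have "64 * \<mu> / real (card U) < snd q / real (card (fst q \<inter> U))"
        using q(2) by (simp add: cost_effectiveness_def)
      moreover have "card (fst q \<inter> U) > 0" using q \<open>finite U\<close> by (simp add: card_gt_0_iff)
      ultimately show "c \<le> snd q \<and> 64 * \<mu> * real (card (fst q \<inter> U)) \<le> snd q * real (card U)"
        using p(2)[OF \<open>q \<in> P'\<close> q(2)] \<open>card U > 0\<close> by (simp add: field_simps)
    qed
    \<comment> \<open>Raising the bound from \<open>a\<close> to \<open>c\<close> lowers the excess
      of each optimal pair of cost at least \<open>c\<close> by exactly \<open>c - a\<close>, and
      increases no excess. This drop pays for \<open>(c - a) * x\<close>.\<close>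
    have "(c - a) * \<nu> + excess c =
        expect (\<lambda>A. (c - a) * real (card {q \<in> opt_cover A. c \<le> snd q}) +
          (\<Sum>q\<in>opt_cover A. max 0 (snd q - c)))"
      by (simp add: \<nu>_def excess_def)
    also have "\<dots> \<le> excess a"
      unfolding excess_def
    proof (rule expect_mono)
      fix A assume A: "A \<in> set_pmf arr"
      have "(c - a) * real (card {q \<in> opt_cover A. c \<le> snd q}) =
          (\<Sum>q\<in>opt_cover A. if c \<le> snd q then c - a else 0)"
        using finite_opt_cover[OF A] by (simp add: sum.If_cases Int_def mult.commute)
      also have "\<dots> + (\<Sum>q\<in>opt_cover A. max 0 (snd q - c)) =
          (\<Sum>q\<in>opt_cover A. (if c \<le> snd q then c - a else 0) + max 0 (snd q - c))"
        by (simp add: sum.distrib)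
      also have "\<dots> \<le> (\<Sum>q\<in>opt_cover A. max 0 (snd q - a))"
        using \<open>a \<le> c\<close> by (intro sum_mono) auto
      finally show "(c - a) * real (card {q \<in> opt_cover A. c \<le> snd q}) +
          (\<Sum>q\<in>opt_cover A. max 0 (snd q - c)) \<le> (\<Sum>q\<in>opt_cover A. max 0 (snd q - a))" .
    qed
    finally have "22 * ln (real l) * ((c - a) * \<nu> + excess c) \<le> 22 * ln (real l) * excess a"
      using l_ge by (intro mult_left_mono) auto
    moreover have "(c - a) * x \<le> (c - a) * (22 * ln (real l) * \<nu>)"
      using x \<open>a \<le> c\<close> by (intro mult_left_mono) auto
    ultimately have "(c - a) * x + 22 * ln (real l) * excess c \<le> 22 * ln (real l) * excess a"
      by (simp add: algebra_simps)
    moreover have "c * prob {A. set_mset A \<inter> (fst p \<inter> U) \<noteq> {}} \<le> c * (real k * (real d / real n))"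
      unfolding d_def using step.prems(1) pos
      by (intro mult_left_mono prob_arrivals_hit_le n_ge) (auto simp: c_def)
    \<comment> \<open>The share of the newly covered tasks pays for the selection; the share of the
      rest is the middle term of the induction hypothesis with bound \<open>c\<close>.\<close>
    moreover have "c * (real k * (real d / real n)) +
        c * (real k * (real (card (U - fst p)) / real n)) = c * x"
      by (simp add: x_def card_U add_divide_distrib algebra_simps)
    moreover have "64 * \<mu> * harm (card (U - fst p)) \<le> 64 * \<mu> * harm (card U)"
      using expected_opt_pos by (intro mult_left_mono harm_mono) (auto simp: card_U)
    moreover have "cost S \<le> 64 * \<mu> * harm (card (U - fst p)) +
        c * (real k * (real (card (U - fst p)) / real n)) + 22 * ln (real l) * excess c"
      using p(2) step.prems(3) pos by (intro IH) (auto simp: c_def)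
    moreover have "(c - a) * x = c * x - a * x" by (rule left_diff_distrib)
    ultimately show ?thesis
      unfolding cost c_def[symmetric] x_def[symmetric] by linarith
  qed
  then show ?case by (simp only: cost_def excess_def)
qed

section \<open>From the run bound to the competitive ratio\<close>

lemma expected_social_cost_le:
  assumes run: "herald_run (64 * \<mu>) P {1..n} S"
  shows "expected_social_cost n k S \<le> 300 * ln (real (l * n)) * \<mu>"
proof -
  have pos: "0 \<le> snd p" if "(p, V) \<in> set S" for p V
    using herald_run_selected[OF run that] cost_pos by (simp add: less_imp_le)
  have swap: "expect (\<lambda>A. \<Sum>(p, V)\<leftarrow>S. snd p * indicator {A. set_mset A \<inter> (fst p \<inter> V) \<noteq> {}} A) =
      (\<Sum>(p, V)\<leftarrow>S. snd p * prob {A. set_mset A \<inter> (fst p \<inter> V) \<noteq> {}})" for S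
    by (induction S) (auto simp del: indicator_simps)
  have "expected_social_cost n k S \<le>
      expect (\<lambda>A. \<Sum>(p, V)\<leftarrow>S. snd p * indicator {A. set_mset A \<inter> (fst p \<inter> V) \<noteq> {}} A)"
    unfolding expected_social_cost_def
    using social_cost_le_sum_list pos by (intro expect_mono) meson
  also have "\<dots> = (\<Sum>(p, V)\<leftarrow>S. snd p * prob {A. set_mset A \<inter> (fst p \<inter> V) \<noteq> {}})"
    by (rule swap)
  \<comment> \<open>Starting from \<open>a = 0\<close> removes the middle term, and the excess over
    0 of an optimal cover is its whole cost.\<close>
  also have "\<dots> \<le> 64 * \<mu> * harm (card {1..n}) + 0 * (real k * (real (card {1..n}) / real n)) +
      22 * ln (real l) * expect (\<lambda>A. \<Sum>p\<in>opt_cover A. max 0 (snd p - 0))"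
    using cost_pos by (intro herald_run_bound[OF run]) (auto simp: less_imp_le)
  also have "expect (\<lambda>A. \<Sum>p\<in>opt_cover A. max 0 (snd p - 0)) \<le> \<mu>"
    unfolding expected_opt_def
  proof (rule expect_mono)
    fix A assume A: "A \<in> set_pmf arr"
    have "(\<Sum>p\<in>opt_cover A. max 0 (snd p - 0)) = sum snd (opt_cover A)"
      using opt_cover_cost_pos[OF A] by (intro sum.cong) (simp_all add: max_absorb2 less_imp_le)
    then show "(\<Sum>p\<in>opt_cover A. max 0 (snd p - 0)) \<le> opt_cost P A"
      by (simp add: opt_cover(3)[OF A])
  qed
  finally have "expected_social_cost n k S \<le> (64 * harm n + 22 * ln (real l)) * \<mu>"
    using l_ge by (simp add: algebra_simps)
  also have "\<dots> \<le> 300 * ln (real (l * n)) * \<mu>"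
  proof (rule mult_right_mono)
    \<comment> \<open>The constant 64 left by the harmonic number is at most
      \<open>96 * ln l\<close>, so the coefficient of \<open>ln l\<close> is at most 118 and that of
      \<open>ln n\<close> is 64.\<close>
    have "2 / 3 \<le> ln (real l)"
      using l_ge ln2_ge_two_thirds by (auto intro: order_trans)
    moreover have "0 \<le> ln (real n)" using n_ge by simp
    moreover have "ln (real (l * n)) = ln (real l) + ln (real n)"
      using l_ge n_ge by (simp add: ln_mult)
    ultimately show "64 * harm n + 22 * ln (real l) \<le> 300 * ln (real (l * n))"
      using harm_le_ln[OF n_ge] by argo
  qed (use expected_opt_pos in simp)
  finally show ?thesis .
qed

end

text \<open>Workers outside \<open>{1..m}\<close> have probability 0, so every drawn bid is the cost
  of an actual worker and hence positive. Every subset occurs in some pair, so all tasks are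
  covered.\<close>

lemma covered_arrivals_matching_pmf:
  assumes "m \<ge> 1" and "n \<ge> 1" and "k \<ge> 1" and "l \<ge> 2"
    and "(\<Union>j\<in>{1..l}. \<Gamma> j) = {1..n}" and "\<forall>i\<in>{1..m}. 0 < c i"
    and P: "P \<in> set_pmf (matching_pmf m l \<Gamma> c \<epsilon> u \<Delta>u)"
  shows "covered_arrivals n k l P"
proof -
  obtain w where P_eq: "P = (\<lambda>j. (\<Gamma> j, c (w j))) ` {1..l}"
    and w: "w \<in> set_pmf (Pi_pmf {1..l} 0 (\<lambda>_. worker_pmf m c \<epsilon> u \<Delta>u))"
    using P by (auto simp: matching_pmf_def)
  have "w j \<in> {1..m}" if "j \<in> {1..l}" for j
  proof -
    have "w j \<in> set_pmf (worker_pmf m c \<epsilon> u \<Delta>u)"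
      using w that by (auto simp: set_Pi_pmf PiE_dflt_def)
    then show ?thesis by (auto simp: set_pmf_eq pmf_worker_pmf[OF assms(1)] split: if_splits)
  qed
  moreover have "card P \<le> l" unfolding P_eq using card_image_le[of "{1..l}"] by simp
  ultimately show ?thesis
    using assms by unfold_locales (auto simp: P_eq)
qed

theorem theorem5:
  shows "\<exists>K::real. K > 0 \<and>
    (\<forall>(m::nat) (n::nat) (l::nat) (\<Gamma> :: nat \<Rightarrow> nat set) (c :: nat \<Rightarrow> real) (bmax::real)
      (u :: real \<Rightarrow> real) (\<Delta>u::real) (\<epsilon>::real)
      (run :: nat \<Rightarrow> matching_pair set \<Rightarrow> (matching_pair \<times> nat set) list).
      l < m * n \<longrightarrow>
      (\<Union>j\<in>{1..l}. \<Gamma> j) = {1..n} \<longrightarrow>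
      (\<forall>t\<in>{1..n}. card {j\<in>{1..l}. t \<in> \<Gamma> j} \<ge> 2) \<longrightarrow>
      (\<forall>i\<in>{1..m}. c i \<in> {1..bmax}) \<longrightarrow>
      bounded (u ` {1..bmax}) \<longrightarrow>
      \<Delta>u = sensitivity u {1..bmax} \<longrightarrow>
      \<Delta>u > 0 \<longrightarrow>
      \<epsilon> > 0 \<longrightarrow>
      (\<forall>k\<in>{1..n}. \<forall>P\<in>set_pmf (matching_pmf m l \<Gamma> c \<epsilon> u \<Delta>u).
         herald_run (64 * expected_opt n k P) P {1..n} (run k P)) \<longrightarrow>
      Max ((\<lambda>k. measure_pmf.expectation (matching_pmf m l \<Gamma> c \<epsilon> u \<Delta>u)
                  (\<lambda>P. expected_social_cost n k (run k P) / expected_opt n k P)) ` {1..n})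
        \<le> K * ln (real (l * n)))"
proof (intro exI[of _ 300] conjI allI impI)
  fix m n l :: nat and \<Gamma> :: "nat \<Rightarrow> nat set" and c :: "nat \<Rightarrow> real" and bmax :: real
    and u :: "real \<Rightarrow> real" and \<Delta>u \<epsilon> :: real
    and run :: "nat \<Rightarrow> matching_pair set \<Rightarrow> (matching_pair \<times> nat set) list"
  assume "l < m * n" and cover: "(\<Union>j\<in>{1..l}. \<Gamma> j) = {1..n}"
    and two: "\<forall>t\<in>{1..n}. card {j\<in>{1..l}. t \<in> \<Gamma> j} \<ge> 2"
    and c: "\<forall>i\<in>{1..m}. c i \<in> {1..bmax}"
    and run: "\<forall>k\<in>{1..n}. \<forall>P\<in>set_pmf (matching_pmf m l \<Gamma> c \<epsilon> u \<Delta>u).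
      herald_run (64 * expected_opt n k P) P {1..n} (run k P)"
  let ?M = "matching_pmf m l \<Gamma> c \<epsilon> u \<Delta>u"
  have m: "m \<ge> 1" and n: "n \<ge> 1" using \<open>l < m * n\<close> by (auto simp: Suc_le_eq intro: gr0I)
  \<comment> \<open>A task in two subsets forces two indices; this keeps \<open>ln l\<close> away
    from 0.\<close>
  have "2 \<le> card {j\<in>{1..l}. 1 \<in> \<Gamma> j}" using two n by simp
  also have "\<dots> \<le> card {1..l}" by (intro card_mono) auto
  finally have l: "l \<ge> 2" by simp
  have "1 \<le> l * n" using l n by (simp add: Suc_le_eq)
  then have ln: "0 \<le> ln (real (l * n))" by (intro ln_ge_zero) (metis of_nat_1 of_nat_mono)
  have "measure_pmf.expectation ?M (\<lambda>P. expected_social_cost n k (run k P) / expected_opt n k P)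
      \<le> 300 * ln (real (l * n))" if k: "k \<in> {1..n}" for k
  proof (cases "integrable ?M (\<lambda>P. expected_social_cost n k (run k P) / expected_opt n k P)")
    case True
    have "expected_social_cost n k (run k P) / expected_opt n k P \<le> 300 * ln (real (l * n))"
      if P: "P \<in> set_pmf ?M" for P
    proof -
      have "\<forall>i\<in>{1..m}. 0 < c i" using c by force
      then interpret covered_arrivals n k l P
        using k by (intro covered_arrivals_matching_pmf[OF m n _ l cover _ P]) auto
      have "expected_social_cost n k (run k P) \<le> 300 * ln (real (l * n)) * expected_opt n k P"
        using run k P by (intro expected_social_cost_le) auto
      then show ?thesis using expected_opt_pos by (simp add: divide_le_eq)
    qed
    then show ?thesis
      using True by (intro measure_pmf.integral_le_const) (auto simp: AE_measure_pmf_iff)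
  next
    \<comment> \<open>The integral of a non-integrable function is 0 by convention, which a
      nonnegative right-hand side dominates.\<close>
    case False
    then show ?thesis using ln by (simp add: not_integrable_integral_eq)
  qed
  then show "Max ((\<lambda>k. measure_pmf.expectation ?M
      (\<lambda>P. expected_social_cost n k (run k P) / expected_opt n k P)) ` {1..n})
      \<le> 300 * ln (real (l * n))"
    using n by (subst Max_le_iff) auto
qed simp

end
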